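(* Let $(W,S)$ be an extended Weyl system with set of reflections $T$, and let $c\in W$ be a Coxeter transformation. Then the reflection length of $c$ equals the rank of the extended Weyl system: $\ell_T(c)=|S|$.
   Context: Let $r\ge 0$ be an integer and $p_1,\dots,p_r$ positive integers. The extended Coxeter–Dynkin diagram $\Gamma$ has vertex set $Q=\{1,1^*\}\cup\{(i,j)\mid 1\le i\le r,\ 1\le j\le p_i-1\}$; there is a single edge between $(i,j)$ and $(i,j+1)$ for $1\le j\le p_i-2$, a single edge between $1$ and $(i,1)$ and between $1^*$ and $(i,1)$ for each $i$ with $p_i\geq 2$, and a dotted double edge between $1$ and $1^*$; there are no other edges. Let $V$ be the real vector space with basis $B=\{\alpha_\nu\mid \nu\in Q\}$ and let $(\cdot\mid\cdot)$ be the symmetric bilinear form with $(\alpha_\nu\mid\alpha_\omega)=2$ if $\nu=\omega$ or $\nu,\omega$ are joined by the dotted double edge, $-1$ if they are joined by a single edge, and $0$ otherwise. For $\alpha\in V$ with $(\alpha\mid\alpha)\ne 0$ let $s_\alpha(v)=v-\frac{2(\alpha\mid v)}{(\alpha\mid\alpha)}\alpha$. The extended Weyl group is $W=\langle s_\alpha\mid\alpha\in B\rangle\le \mathrm{GL}(V)$, with simple system $S=\{s_\alpha\mid \alpha\in B\}$; $(W,S)$ is called an extended Weyl system and $|S|=|B|$ its rank. The set of reflections is $T=\bigcup_{w\in W}wSw^{-1}$. For $x\in W$, $\ell_T(x)$ is the smallest $m$ such that $x$ is a product of $m$ elements of $T$. A Coxeter transformation is an element $c=\Big(\prod_{\alpha\in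 B\setminus\{\alpha_1,\alpha_{1^*}\}}s_\alpha\Big)\cdot s_{\alpha_1}s_{\alpha_{1^*}}$, where the first $|B|-2$ factors are taken in an arbitrary order. *)

theory Defs
  imports
    "HOL-Algebra.Bij"
    "HOL-Algebra.Generated_Groups"
    "HOL-Analysis.Finite_Function_Topology"
begin

text \<open>
  The parameters \<open>r\<close> and \<open>p\<close> are the number of arms and their weights; only the values
  \<open>p i\<close> with \<open>1 \<le> i \<le> r\<close> are ever used.
\<close>

datatype vertex = One | OneStar | Arm nat nat

definition vertices :: "nat \<Rightarrow> (nat \<Rightarrow> nat) \<Rightarrow> vertex set" where
  "vertices r p = {One, OneStar} \<union> {Arm i j | i j. i \<in> {1..r} \<and> j \<in> {1..p i - 1}}"

definition single_edges :: "nat \<Rightarrow> (nat \<Rightarrow> nat) \<Rightarrow> vertex set set" where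
  "single_edges r p =
     {{Arm i j, Arm i (j + 1)} | i j. i \<in> {1..r} \<and> j \<in> {1..p i - 2}}
     \<union> {{One, Arm i 1} | i. i \<in> {1..r} \<and> p i \<ge> 2}
     \<union> {{OneStar, Arm i 1} | i. i \<in> {1..r} \<and> p i \<ge> 2}"

definition dotted_edges :: "vertex set set" where
  "dotted_edges = {{One, OneStar}}"

definition gram :: "nat \<Rightarrow> (nat \<Rightarrow> nat) \<Rightarrow> vertex \<Rightarrow> vertex \<Rightarrow> real" where
  "gram r p \<nu> \<omega> =
     (if \<nu> = \<omega> \<or> {\<nu>, \<omega>} \<in> dotted_edges then 2
      else if {\<nu>, \<omega>} \<in> single_edges r p then -1
      else 0)"

text \<open>
  The space \<open>V\<close> is realised inside the free real vector space on all vertex names; its basis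
  vectors are the formal basis vectors of the vertices that occur in the diagram.
\<close>

type_synonym vec = "vertex \<Rightarrow>\<^sub>0 real"

definition simple_root :: "vertex \<Rightarrow> vec" where
  "simple_root \<nu> = Poly_Mapping.single \<nu> 1"

definition simple_roots :: "nat \<Rightarrow> (nat \<Rightarrow> nat) \<Rightarrow> vec set" where
  "simple_roots r p = simple_root ` vertices r p"

definition root_space :: "nat \<Rightarrow> (nat \<Rightarrow> nat) \<Rightarrow> vec set" where
  "root_space r p = span (simple_roots r p)"

definition form :: "nat \<Rightarrow> (nat \<Rightarrow> nat) \<Rightarrow> vec \<Rightarrow> vec \<Rightarrow> real" where
  "form r p u v =
     (\<Sum>\<nu>\<in>vertices r p. \<Sum>\<omega>\<in>vertices r p.
        Poly_Mapping.lookup u \<nu> * Poly_Mapping.lookup v \<omega> * gram r p \<nu> \<omega>)"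

text \<open>
  Elements of \<open>GL(V)\<close> are functions on the ambient space that are \<open>undefined\<close> outside \<open>V\<close>,
  following \<^const>\<open>BijGroup\<close>; products are compositions, the right factor acting first.
\<close>

definition GL :: "vec set \<Rightarrow> (vec \<Rightarrow> vec) monoid" where
  "GL V = BijGroup V
     \<lparr>carrier := {f \<in> Bij V. (\<forall>u\<in>V. \<forall>v\<in>V. f (u + v) = f u + f v) \<and>
                            (\<forall>a. \<forall>v\<in>V. f (a *\<^sub>R v) = a *\<^sub>R f v)}\<rparr>"

abbreviation GLV :: "nat \<Rightarrow> (nat \<Rightarrow> nat) \<Rightarrow> (vec \<Rightarrow> vec) monoid" where
  "GLV r p \<equiv> GL (root_space r p)"

definition reflection :: "nat \<Rightarrow> (nat \<Rightarrow> nat) \<Rightarrow> vec \<Rightarrow> (vec \<Rightarrow> vec)" where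
  "reflection r p \<alpha> =
     (\<lambda>v\<in>root_space r p. v - (2 * form r p \<alpha> v / form r p \<alpha> \<alpha>) *\<^sub>R \<alpha>)"

definition simple_reflections :: "nat \<Rightarrow> (nat \<Rightarrow> nat) \<Rightarrow> (vec \<Rightarrow> vec) set" where
  "simple_reflections r p = reflection r p ` simple_roots r p"

definition extended_weyl_group :: "nat \<Rightarrow> (nat \<Rightarrow> nat) \<Rightarrow> (vec \<Rightarrow> vec) set" where
  "extended_weyl_group r p = generate (GLV r p) (simple_reflections r p)"

definition reflections :: "nat \<Rightarrow> (nat \<Rightarrow> nat) \<Rightarrow> (vec \<Rightarrow> vec) set" where
  "reflections r p =
     {w \<otimes>\<^bsub>GLV r p\<^esub> s \<otimes>\<^bsub>GLV r p\<^esub> inv\<^bsub>GLV r p\<^esub> w | w s.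
        w \<in> extended_weyl_group r p \<and> s \<in> simple_reflections r p}"

definition list_product :: "('a, 'b) monoid_scheme \<Rightarrow> 'a list \<Rightarrow> 'a" where
  "list_product G xs = foldr (\<lambda>x y. x \<otimes>\<^bsub>G\<^esub> y) xs \<one>\<^bsub>G\<^esub>"

definition reflection_length :: "nat \<Rightarrow> (nat \<Rightarrow> nat) \<Rightarrow> (vec \<Rightarrow> vec) \<Rightarrow> nat" where
  "reflection_length r p x =
     (LEAST m. \<exists>ts. length ts = m \<and> set ts \<subseteq> reflections r p \<and> list_product (GLV r p) ts = x)"

definition coxeter_transformation :: "nat \<Rightarrow> (nat \<Rightarrow> nat) \<Rightarrow> (vec \<Rightarrow> vec) \<Rightarrow> bool" where
  "coxeter_transformation r p c \<longleftrightarrow>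
     (\<exists>\<alpha>s. distinct \<alpha>s \<and>
           set \<alpha>s = simple_roots r p - {simple_root One, simple_root OneStar} \<and>
           c = list_product (GLV r p)
                 (map (reflection r p) (\<alpha>s @ [simple_root One, simple_root OneStar])))"

end

theory Submission
  imports "Jordan_Normal_Form.Determinant" Defs
begin

text \<open>
  Put \<open>a = \<alpha>\<^bsub>1*\<^esub> - \<alpha>\<^sub>1\<close>, a radical vector, and let \<open>A\<close> be the span of the \<open>n - 2\<close> simple roots on the
  arms. Then \<open>c v = c' v - (\<alpha>\<^sub>1 | v) a\<close>, where \<open>c'\<close> is the product of the arm reflections. Determinants
  show that any factorisation of \<open>c\<close> into \<open>k\<close> reflections has \<open>k \<equiv> n\<close> modulo \<open>2\<close>, so only
  \<open>k \<le> n - 2\<close> has to be excluded. As \<open>c' - 1\<close> is injective on \<open>A\<close>, the space \<open>A\<close> lies in the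
  span of the roots of the factorisation modulo \<open>a\<close>, and counting dimensions shows that these roots
  lie in \<open>A\<close>. The \<open>a\<close>-coefficient of \<open>v - c v\<close> is of the form \<open>(z | v)\<close> for an integral
  combination \<open>z\<close> of those roots. Hence \<open>(z | v) = (\<alpha>\<^sub>1 | v)\<close> for all \<open>v\<close> with an integral
  vector \<open>z \<in> A\<close>. But on an arm of type \<open>A\<^bsub>p-1\<^esub>\<close> such a \<open>z\<close> is minus a fundamental weight, with
  leading coefficient \<open>-(p - 1)/p\<close>, which is not an integer. The argument covers the degenerate
  (tubular) case, in which dimension counts for fixed spaces alone do not suffice.
\<close>

section \<open>Coordinates in the free vector space on vertex names\<close>

lemma lookup_scaleR [simp]: "Poly_Mapping.lookup (a *\<^sub>R v) x = a *\<^sub>R Poly_Mapping.lookup v x"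
proof -
  have "finite {i. a *\<^sub>R Poly_Mapping.lookup v i \<noteq> 0}"
    by (rule finite_subset[OF _ finite_keys[of v]]) (auto simp: in_keys_iff)
  then show ?thesis
    by (simp add: scaleR_poly_mapping_def Abs_poly_mapping_inverse)
qed

lemma simple_root_expansion:
  assumes "finite X" "\<And>x. x \<notin> X \<Longrightarrow> Poly_Mapping.lookup v x = 0"
  shows "v = (\<Sum>x\<in>X. Poly_Mapping.lookup v x *\<^sub>R simple_root x)"
proof (rule poly_mapping_eqI)
  fix y
  have "(\<Sum>x\<in>X. Poly_Mapping.lookup v x * (1 when x = y))
      = (\<Sum>x\<in>X. if x = y then Poly_Mapping.lookup v x else 0)"
    by (intro sum.cong) auto
  then show "Poly_Mapping.lookup v y
      = Poly_Mapping.lookup (\<Sum>x\<in>X. Poly_Mapping.lookup v x *\<^sub>R simple_root x) y"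
    using assms by (auto simp: lookup_sum simple_root_def lookup_single)
qed

lemma lookup_simple_root: "Poly_Mapping.lookup (simple_root x) y = (if x = y then 1 else 0)"
  by (auto simp: simple_root_def lookup_single)

lemma simple_root_inject [simp]: "simple_root x = simple_root y \<longleftrightarrow> x = y"
  by (metis lookup_simple_root zero_neq_one)

lemma inj_simple_root: "inj_on simple_root X"
  by (auto intro: inj_onI)

lemma span_simple_root:
  assumes "finite X"
  shows "v \<in> span (simple_root ` X) \<longleftrightarrow> (\<forall>x. x \<notin> X \<longrightarrow> Poly_Mapping.lookup v x = 0)"
proof
  show "\<forall>x. x \<notin> X \<longrightarrow> Poly_Mapping.lookup v x = 0" if "v \<in> span (simple_root ` X)"
    using that
  proof (induction rule: span_induct_alt)
    case (step c x y)
    then show ?case by (force simp: lookup_add lookup_simple_root)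
  qed simp
  show "v \<in> span (simple_root ` X)" if "\<forall>x. x \<notin> X \<longrightarrow> Poly_Mapping.lookup v x = 0"
    by (subst simple_root_expansion[OF assms]) (use that in \<open>auto intro: span_sum span_scale span_base\<close>)
qed

lemma independent_simple_roots:
  assumes "finite X"
  shows "independent (simple_root ` X)"
proof (rule independent_if_scalars_zero)
  show "finite (simple_root ` X)" using assms by simp
  fix f y assume *: "(\<Sum>x\<in>simple_root ` X. f x *\<^sub>R x) = 0" and y: "y \<in> simple_root ` X"
  from y obtain x where x: "x \<in> X" "y = simple_root x" by auto
  have "0 = (\<Sum>z\<in>X. Poly_Mapping.lookup (f (simple_root z) *\<^sub>R simple_root z) x)"
    using arg_cong[OF *, of "\<lambda>v. Poly_Mapping.lookup v x"]
    by (simp add: sum.reindex inj_simple_root lookup_sum)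
  also have "\<dots> = (\<Sum>z\<in>X. if z = x then f (simple_root z) else 0)"
    by (intro sum.cong) (auto simp: lookup_simple_root)
  also have "\<dots> = f y" using assms x by simp
  finally show "f y = 0" by simp
qed

section \<open>The bilinear form of the diagram\<close>

locale extended_diagram =
  fixes r :: nat and p :: "nat \<Rightarrow> nat"
begin

abbreviation "X \<equiv> vertices r p"
abbreviation "V \<equiv> root_space r p"
abbreviation frm :: "vec \<Rightarrow> vec \<Rightarrow> real" (\<open>\<langle>_, _\<rangle>\<close>) where "\<langle>u, v\<rangle> \<equiv> form r p u v"

lemma finite_vertices: "finite X"
proof -
  have "X \<subseteq> {One, OneStar} \<union> (\<lambda>(i, j). Arm i j) ` (SIGMA i:{1..r}. {1..p i - 1})"
    by (auto simp: vertices_def)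
  then show ?thesis
    by (rule finite_subset) auto
qed

lemma vertices_special [simp]: "One \<in> X" "OneStar \<in> X"
  by (auto simp: vertices_def)

lemma Arm_in_vertices: "Arm i j \<in> X \<longleftrightarrow> i \<in> {1..r} \<and> 1 \<le> j \<and> j < p i"
  by (auto simp: vertices_def)

lemma mem_root_space: "v \<in> V \<longleftrightarrow> (\<forall>x. x \<notin> X \<longrightarrow> Poly_Mapping.lookup v x = 0)"
  unfolding root_space_def simple_roots_def by (rule span_simple_root[OF finite_vertices])

lemma subspace_root_space: "subspace V"
  by (simp add: root_space_def)

lemma simple_root_mem [simp]: "x \<in> X \<Longrightarrow> simple_root x \<in> V"
  by (auto simp: mem_root_space lookup_simple_root)

lemma form_sym: "\<langle>u, v\<rangle> = \<langle>v, u\<rangle>"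
proof -
  have "gram r p x y = gram r p y x" for x y by (auto simp: gram_def insert_commute)
  then show ?thesis unfolding form_def by (subst sum.swap) (simp add: mult_ac)
qed

lemma linear_form: "linear (form r p u)"
  by (rule linearI)
     (auto simp: form_def lookup_add algebra_simps sum.distrib sum_distrib_left intro!: sum.cong)

lemmas form_right [simp] =
  linear_add[OF linear_form] linear_diff[OF linear_form] linear_scale[OF linear_form]
  linear_0[OF linear_form]

lemma form_left [simp]:
  "\<langle>u + v, w\<rangle> = \<langle>u, w\<rangle> + \<langle>v, w\<rangle>" "\<langle>u - v, w\<rangle> = \<langle>u, w\<rangle> - \<langle>v, w\<rangle>"
  "\<langle>a *\<^sub>R u, w\<rangle> = a * \<langle>u, w\<rangle>" "\<langle>0, w\<rangle> = 0"
  by (simp_all add: form_sym[of _ w])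

lemma form_simple_root:
  assumes "x \<in> X"
  shows "\<langle>simple_root x, v\<rangle> = (\<Sum>y\<in>X. Poly_Mapping.lookup v y * gram r p x y)"
proof -
  have "\<langle>simple_root x, v\<rangle>
      = (\<Sum>z\<in>X. if z = x then \<Sum>y\<in>X. Poly_Mapping.lookup v y * gram r p x y else 0)"
    unfolding form_def by (intro sum.cong) (auto simp: lookup_simple_root)
  then show ?thesis using assms finite_vertices by simp
qed

lemma form_simple_roots:
  assumes "x \<in> X" "y \<in> X"
  shows "\<langle>simple_root x, simple_root y\<rangle> = gram r p x y"
proof -
  have "\<langle>simple_root x, simple_root y\<rangle> = (\<Sum>z\<in>X. if z = y then gram r p x y else 0)"
    unfolding form_simple_root[OF assms(1)] by (intro sum.cong) (auto simp: lookup_simple_root)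
  then show ?thesis using assms finite_vertices by simp
qed

lemma gram_same [simp]: "gram r p x x = 2"
  by (simp add: gram_def)

text \<open>The bound \<open>p i - 2\<close> on the lower endpoint of an edge follows because the
  upper endpoint is itself a vertex.\<close>

lemma gram_Arm_Arm:
  assumes "Arm i j \<in> X" "Arm k l \<in> X"
  shows "gram r p (Arm i j) (Arm k l) =
    (if i = k \<and> j = l then 2 else if i = k \<and> (l = j + 1 \<or> j = l + 1) then -1 else 0)"
proof -
  have "{Arm i j, Arm k l} \<in> single_edges r p \<longleftrightarrow> i = k \<and> (l = j + 1 \<or> j = l + 1)" (is "?L \<longleftrightarrow> ?R")
  proof
    show ?R if ?L using that by (auto simp: single_edges_def doubleton_eq_iff)
    show ?L if ?R
    proof -
      from that have "i = k" by simp
      from that consider "l = j + 1" | "j = l + 1" by blast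
      then show ?L
      proof cases
        case 1
        have "{Arm i j, Arm i (j + 1)} \<in> single_edges r p"
          unfolding single_edges_def using assms 1 \<open>i = k\<close>
          by (intro UnI1 CollectI, rule_tac x = i in exI, rule_tac x = j in exI)
            (auto simp: Arm_in_vertices)
        then show ?thesis using 1 \<open>i = k\<close> by simp
      next
        case 2
        have "{Arm i l, Arm i (l + 1)} \<in> single_edges r p"
          unfolding single_edges_def using assms 2 \<open>i = k\<close>
          by (intro UnI1 CollectI, rule_tac x = i in exI, rule_tac x = l in exI)
            (auto simp: Arm_in_vertices)
        then show ?thesis using 2 \<open>i = k\<close> by (simp add: insert_commute)
      qed
    qed
  qed
  then show ?thesis by (auto simp: gram_def dotted_edges_def doubleton_eq_iff)
qed

lemma gram_One_Arm:
  assumes "Arm i j \<in> X"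
  shows "gram r p One (Arm i j) = (if j = 1 then -1 else 0)"
    and "gram r p OneStar (Arm i j) = (if j = 1 then -1 else 0)"
  using assms
  by (auto simp: gram_def dotted_edges_def single_edges_def doubleton_eq_iff Arm_in_vertices)

lemma gram_One_OneStar: "gram r p One OneStar = 2" "gram r p OneStar One = 2"
  by (auto simp: gram_def dotted_edges_def)

text \<open>The dotted edge carries the diagonal value 2, and \<open>One\<close> and
  \<open>OneStar\<close> have the same neighbours on the arms, so their rows of the Gram matrix
  coincide. This puts the difference of the two simple roots into the radical.\<close>

lemma form_OneStar: "\<langle>simple_root OneStar, v\<rangle> = \<langle>simple_root One, v\<rangle>"
proof -
  have "gram r p OneStar x = gram r p One x" if "x \<in> X" for x
    using that by (cases x) (auto simp: gram_One_Arm gram_One_OneStar)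
  then show ?thesis by (simp add: form_simple_root)
qed

lemma gram_Ints: "gram r p x y \<in> \<int>"
  by (auto simp: gram_def)

section \<open>The arms as chains of type A\<close>

abbreviation "arms \<equiv> X - {One, OneStar}"
abbreviation "arm_space \<equiv> span (simple_root ` arms)"

lemma mem_arm_space: "v \<in> arm_space \<longleftrightarrow> (\<forall>x. x \<notin> arms \<longrightarrow> Poly_Mapping.lookup v x = 0)"
  by (rule span_simple_root) (simp add: finite_vertices)

lemma arm_space_subset: "arm_space \<subseteq> V"
  unfolding root_space_def simple_roots_def by (rule span_mono) auto

text \<open>The second-difference formula also covers both ends of an arm: \<open>Arm i 0\<close>
  and \<open>Arm i (p i)\<close> are not vertices, so \<open>v\<close> has coordinate 0
  there.\<close>

lemma form_Arm:
  assumes x: "Arm i j \<in> X" and v: "v \<in> arm_space"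
  shows "\<langle>simple_root (Arm i j), v\<rangle> =
    2 * Poly_Mapping.lookup v (Arm i j) - Poly_Mapping.lookup v (Arm i (j - 1))
      - Poly_Mapping.lookup v (Arm i (j + 1))"
proof -
  let ?l = "Poly_Mapping.lookup v" and ?g = "\<lambda>k l. if i = k \<and> j = l then 2
    else if i = k \<and> (l = j + 1 \<or> j = l + 1) then -1 else (0::real)"
  let ?N = "{Arm i j, Arm i (j - 1), Arm i (j + 1)}"
  let ?h = "\<lambda>y. ?l y * (case y of Arm k l \<Rightarrow> ?g k l | _ \<Rightarrow> 0)"
  \<comment> \<open>Positivity keeps the truncated \<open>j - 1\<close> different from
    \<open>j\<close>, so \<open>?N\<close> has three elements.\<close>
  have j: "j \<ge> 1" using x by (simp add: Arm_in_vertices)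
  have "\<langle>simple_root (Arm i j), v\<rangle> = sum ?h X"
    unfolding form_simple_root[OF x]
    using v x by (intro sum.cong) (auto simp: gram_Arm_Arm mem_arm_space split: vertex.split)
  \<comment> \<open>A neighbour may fall outside \<open>X\<close>, where \<open>v\<close> vanishes;
    adding it to the index set changes nothing and lets the sum shrink to \<open>?N\<close>.\<close>
  also have "\<dots> = sum ?h (X \<union> ?N)"
    using v by (intro sum.mono_neutral_left) (auto simp: mem_arm_space finite_vertices)
  also have "\<dots> = sum ?h ?N"
    by (intro sum.mono_neutral_right) (auto simp: finite_vertices split: vertex.split)
  also have "\<dots> = 2 * ?l (Arm i j) - ?l (Arm i (j - 1)) - ?l (Arm i (j + 1))"
    using j by (cases j) auto
  finally show ?thesis .
qed

text \<open>An arm vector whose pairings with the inner vertices of arm \<open>i\<close> vanish is affine along the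
  arm; the virtual value at position \<open>0\<close> is the pairing with the first vertex.\<close>

lemma arm_discrete_harmonic:
  assumes v: "v \<in> arm_space" and x: "Arm i 1 \<in> X"
    and inner: "\<And>j. 2 \<le> j \<Longrightarrow> j < p i \<Longrightarrow> \<langle>simple_root (Arm i j), v\<rangle> = 0"
    and j: "1 \<le> j" "j \<le> p i"
  shows "real (p i) * Poly_Mapping.lookup v (Arm i j)
    = real (p i - j) * \<langle>simple_root (Arm i 1), v\<rangle>"
proof -
  define y where "y = Poly_Mapping.lookup v (Arm i 1)"
  define q where "q = \<langle>simple_root (Arm i 1), v\<rangle>"
  have i: "i \<in> {1..r}" and pi: "1 < p i" using x by (auto simp: Arm_in_vertices)
  have 0: "Poly_Mapping.lookup v (Arm i 0) = 0" using v by (auto simp: mem_arm_space Arm_in_vertices)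
  have q: "q = 2 * y - Poly_Mapping.lookup v (Arm i 2)"
    using form_Arm[OF x v] 0 by (simp add: q_def y_def numeral_2_eq_2)
  \<comment> \<open>Two consecutive values are carried along because the recurrence has order two.
    The clause for position \<open>m\<close> is guarded: at position 0 the affine function takes the
    value \<open>q\<close>, whereas the actual coordinate is 0.\<close>
  have affine: "Poly_Mapping.lookup v (Arm i (Suc m)) = y + real m * (y - q)
      \<and> (m \<ge> 1 \<longrightarrow> Poly_Mapping.lookup v (Arm i m) = y + (real m - 1) * (y - q))"
    if "Suc m \<le> p i" for m
    using that
  proof (induction m)
    case 0
    then show ?case by (simp add: y_def)
  next
    case (Suc m)
    show ?case
    proof (cases "m = 0")
      case True
      then show ?thesis using q by (simp add: y_def numeral_2_eq_2)
    next
      case False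
      then have "\<langle>simple_root (Arm i (Suc m)), v\<rangle> = 0" and "Arm i (Suc m) \<in> X"
        using Suc.prems i by (auto intro!: inner simp: Arm_in_vertices)
      then have "Poly_Mapping.lookup v (Arm i (Suc (Suc m)))
          = 2 * Poly_Mapping.lookup v (Arm i (Suc m)) - Poly_Mapping.lookup v (Arm i m)"
        using form_Arm[of i "Suc m", OF _ v] by simp
      then show ?thesis using Suc False by (simp add: algebra_simps)
    qed
  qed
  \<comment> \<open>Vanishing just past the end of the arm fixes the slope \<open>y - q\<close> as
    \<open>- q / p i\<close>.\<close>
  have "Poly_Mapping.lookup v (Arm i (p i)) = 0"
    using v by (auto simp: mem_arm_space Arm_in_vertices)
  with affine[of "p i - 1"] pi have "y + (real (p i) - 1) * (y - q) = 0"
    by (simp add: of_nat_diff)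
  then have slope: "real (p i) * (y - q) = - q" by (simp add: algebra_simps)
  have "Poly_Mapping.lookup v (Arm i j) = y + (real j - 1) * (y - q)"
    using affine[of "j - 1"] j by (simp add: of_nat_diff)
  then have "real (p i) * Poly_Mapping.lookup v (Arm i j)
      = real (p i) * y + (real j - 1) * (real (p i) * (y - q))"
    by (simp only: distrib_left mult.left_commute)
  also have "\<dots> = real (p i - j) * q"
    unfolding slope using slope j by (simp add: algebra_simps of_nat_diff)
  finally show ?thesis by (simp add: q_def)
qed

text \<open>If all pairings vanish, including the one at the first vertex, then the affine profile
  along each arm starts at the virtual value 0 and ends at 0, so it is zero throughout.\<close>

lemma form_nondegenerate_on_arm_space:
  assumes v: "v \<in> arm_space" and orth: "\<And>x. x \<in> arms \<Longrightarrow> \<langle>simple_root x, v\<rangle> = 0"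
  shows "v = 0"
proof (rule poly_mapping_eqI)
  fix x
  show "Poly_Mapping.lookup v x = Poly_Mapping.lookup 0 x"
  proof (cases "x \<in> arms")
    case False
    then show ?thesis using v by (simp add: mem_arm_space)
  next
    case True
    then obtain i j where x: "x = Arm i j" by (cases x) auto
    with True have j: "i \<in> {1..r}" "1 \<le> j" "j < p i" by (auto simp: Arm_in_vertices)
    then have "Arm i 1 \<in> X" by (simp add: Arm_in_vertices)
    then have "real (p i) * Poly_Mapping.lookup v (Arm i j) = 0"
      using arm_discrete_harmonic[OF v, of i j] j orth
      by (auto simp: Arm_in_vertices)
    then show ?thesis using j x by simp
  qed
qed

section \<open>The linear group, the root lattice and the roots of reflections\<close>

abbreviation "G \<equiv> GLV r p"

text \<open>The reflection formula specialised to norm 2, kept total on the ambient space so that it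
  is linear there; for such vectors its restriction to \<open>V\<close> is
  \<open>reflection\<close>.\<close>

definition refl_map :: "vec \<Rightarrow> vec \<Rightarrow> vec" where
  "refl_map \<beta> v = v - \<langle>\<beta>, v\<rangle> *\<^sub>R \<beta>"

definition root_lattice :: "vec set" where
  "root_lattice = {v \<in> V. \<forall>x. Poly_Mapping.lookup v x \<in> \<int>}"

text \<open>The vectors of norm \<open>2\<close> in the root lattice contain all roots; the converse plays no role.\<close>

definition lattice_roots :: "vec set" where
  "lattice_roots = {\<beta> \<in> root_lattice. \<langle>\<beta>, \<beta>\<rangle> = 2}"

lemma root_lattice_diff: "u \<in> root_lattice \<Longrightarrow> v \<in> root_lattice \<Longrightarrow> u - v \<in> root_lattice"
  by (auto simp: root_lattice_def lookup_minus mem_root_space)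

lemma root_lattice_add: "u \<in> root_lattice \<Longrightarrow> v \<in> root_lattice \<Longrightarrow> u + v \<in> root_lattice"
  by (auto simp: root_lattice_def lookup_add mem_root_space)

lemma root_lattice_scale: "c \<in> \<int> \<Longrightarrow> v \<in> root_lattice \<Longrightarrow> c *\<^sub>R v \<in> root_lattice"
  by (auto simp: root_lattice_def mem_root_space)

lemma form_root_lattice: "u \<in> root_lattice \<Longrightarrow> v \<in> root_lattice \<Longrightarrow> \<langle>u, v\<rangle> \<in> \<int>"
  by (auto simp: root_lattice_def form_def gram_Ints intro!: Ints_sum Ints_mult)

lemma simple_root_lattice_root: "x \<in> X \<Longrightarrow> simple_root x \<in> lattice_roots"
  by (auto simp: lattice_roots_def root_lattice_def lookup_simple_root form_simple_roots)

lemma lattice_roots_subset: "lattice_roots \<subseteq> V"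
  by (auto simp: lattice_roots_def root_lattice_def)

lemma linear_refl_map: "linear (refl_map \<beta>)"
  by (rule linearI) (auto simp: refl_map_def algebra_simps)

lemma refl_map_in_root_space: "\<beta> \<in> V \<Longrightarrow> v \<in> V \<Longrightarrow> refl_map \<beta> v \<in> V"
  by (auto simp: refl_map_def mem_root_space lookup_minus)

lemma refl_map_involution: "\<langle>\<beta>, \<beta>\<rangle> = 2 \<Longrightarrow> refl_map \<beta> (refl_map \<beta> v) = v"
  by (simp add: refl_map_def algebra_simps)

lemma refl_map_isometry: "\<langle>\<beta>, \<beta>\<rangle> = 2 \<Longrightarrow> \<langle>refl_map \<beta> u, refl_map \<beta> v\<rangle> = \<langle>u, v\<rangle>"
  by (simp add: refl_map_def algebra_simps form_sym[of u \<beta>])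

lemma refl_map_self_adjoint: "\<langle>refl_map \<beta> u, v\<rangle> = \<langle>u, refl_map \<beta> v\<rangle>"
  by (simp add: refl_map_def algebra_simps form_sym[of u \<beta>])

lemma refl_map_root_lattice: "\<beta> \<in> root_lattice \<Longrightarrow> v \<in> root_lattice \<Longrightarrow> refl_map \<beta> v \<in> root_lattice"
  unfolding refl_map_def by (intro root_lattice_diff root_lattice_scale form_root_lattice)

lemma reflection_eq: "\<langle>\<beta>, \<beta>\<rangle> = 2 \<Longrightarrow> reflection r p \<beta> = restrict (refl_map \<beta>) V"
  by (auto simp: reflection_def refl_map_def)

lemma carrier_GL:
  "f \<in> carrier G \<longleftrightarrow> f \<in> Bij V \<and> (\<forall>u\<in>V. \<forall>v\<in>V. f (u + v) = f u + f v) \<and>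
    (\<forall>a. \<forall>v\<in>V. f (a *\<^sub>R v) = a *\<^sub>R f v)"
  by (simp add: GL_def)

lemma GL_mult: "f \<in> carrier G \<Longrightarrow> g \<in> carrier G \<Longrightarrow> f \<otimes>\<^bsub>G\<^esub> g = compose V f g"
  by (simp add: GL_def BijGroup_def)

lemma GL_one: "\<one>\<^bsub>G\<^esub> = restrict id V"
  by (auto simp: GL_def BijGroup_def)

lemma carrier_GL_closed: "f \<in> carrier G \<Longrightarrow> v \<in> V \<Longrightarrow> f v \<in> V"
  using Bij_imp_funcset by (auto simp: carrier_GL)

lemma group_GL: "group G"
proof -
  have "subgroup {f \<in> Bij V. (\<forall>u\<in>V. \<forall>v\<in>V. f (u + v) = f u + f v) \<and>
      (\<forall>a. \<forall>v\<in>V. f (a *\<^sub>R v) = a *\<^sub>R f v)} (BijGroup V)" (is "subgroup ?H _")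
  proof
    show "?H \<subseteq> carrier (BijGroup V)" by (auto simp: BijGroup_def)
    show "\<one>\<^bsub>BijGroup V\<^esub> \<in> ?H"
      by (auto simp: BijGroup_def id_Bij subspace_root_space subspace_add subspace_scale)
    fix f assume f: "f \<in> ?H"
    then have fV: "f v \<in> V" if "v \<in> V" for v using that Bij_imp_funcset by auto
    show "f \<otimes>\<^bsub>BijGroup V\<^esub> g \<in> ?H" if g: "g \<in> ?H" for g
    proof -
      have "g v \<in> V" if "v \<in> V" for v using that g Bij_imp_funcset by auto
      then show ?thesis using f g
        by (auto simp: BijGroup_def compose_Bij compose_eq subspace_root_space subspace_add subspace_scale)
    qed
    have "inv\<^bsub>BijGroup V\<^esub> f = restrict (inv_into V f) V"
      using f by (simp add: inv_BijGroup)
    moreover have "restrict (inv_into V f) V \<in> Bij V"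
      using f by (simp add: restrict_inv_into_Bij)
    moreover have "inv_into V f (u + v) = inv_into V f u + inv_into V f v" if "u \<in> V" "v \<in> V" for u v
      using Bij_inv_into_lemma[where S = V and h = f and g = "(+)" and x = u and y = v] that f
      by (auto simp: subspace_root_space subspace_add)
    \<comment> \<open>Scaling is treated as a binary operation that ignores its second argument, so
      the same lemma about inverses applies as for addition.\<close>
    moreover have "inv_into V f (a *\<^sub>R v) = a *\<^sub>R inv_into V f v" if "v \<in> V" for a v
      using Bij_inv_into_lemma[where S = V and h = f and g = "\<lambda>u v. a *\<^sub>R v" and x = v and y = v] that f
      by (auto simp: subspace_root_space subspace_scale)
    ultimately show "inv\<^bsub>BijGroup V\<^esub> f \<in> ?H"
      by (auto simp: subspace_root_space subspace_add subspace_scale)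
  qed
  then have "group (BijGroup V\<lparr>carrier := ?H\<rparr>)"
    by (rule subgroup.subgroup_is_group) (rule group_BijGroup)
  then show ?thesis unfolding GL_def .
qed

lemma refl_map_in_GL:
  assumes "\<beta> \<in> V" "\<langle>\<beta>, \<beta>\<rangle> = 2"
  shows "restrict (refl_map \<beta>) V \<in> carrier G"
proof -
  have "bij_betw (refl_map \<beta>) V V"
    by (rule bij_betw_byWitness[of _ "refl_map \<beta>"])
       (use assms in \<open>auto simp: refl_map_involution refl_map_in_root_space\<close>)
  then show ?thesis
    by (auto simp: carrier_GL Bij_def linear_add[OF linear_refl_map] linear_scale[OF linear_refl_map]
        subspace_root_space subspace_add subspace_scale cong: bij_betw_cong)
qed

lemma simple_reflection_cases:
  assumes "s \<in> simple_reflections r p"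
  obtains x where "x \<in> X" "s = restrict (refl_map (simple_root x)) V"
  using assms that
  by (auto simp: simple_reflections_def simple_roots_def reflection_eq form_simple_roots)

lemma simple_reflections_subset: "simple_reflections r p \<subseteq> carrier G"
  by (auto elim!: simple_reflection_cases intro!: refl_map_in_GL simp: form_simple_roots)

lemma inv_simple_reflection:
  assumes "s \<in> simple_reflections r p"
  shows "inv\<^bsub>G\<^esub> s = s"
proof (rule group.inv_equality[OF group_GL])
  show s: "s \<in> carrier G" "s \<in> carrier G" using assms simple_reflections_subset by auto
  obtain x where x: "x \<in> X" "s = restrict (refl_map (simple_root x)) V"
    using assms by (rule simple_reflection_cases)
  have ss: "s (s v) = v" if "v \<in> V" for v
    using that x by (simp add: refl_map_in_root_space refl_map_involution form_simple_roots)
  show "s \<otimes>\<^bsub>G\<^esub> s = \<one>\<^bsub>G\<^esub>"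
    unfolding GL_mult[OF s] GL_one by (rule ext) (simp add: compose_def ss)
qed

lemma simple_reflection_action:
  assumes "s \<in> simple_reflections r p"
  shows "s \<in> carrier G \<and> (\<forall>u\<in>V. \<forall>v\<in>V. \<langle>s u, s v\<rangle> = \<langle>u, v\<rangle>) \<and> s ` root_lattice \<subseteq> root_lattice"
proof (intro conjI ballI)
  obtain x where x: "x \<in> X" "s = restrict (refl_map (simple_root x)) V"
    using assms by (rule simple_reflection_cases)
  then have \<alpha>: "simple_root x \<in> root_lattice" "\<langle>simple_root x, simple_root x\<rangle> = 2"
    using simple_root_lattice_root by (auto simp: lattice_roots_def)
  show "s \<in> carrier G" using assms simple_reflections_subset by blast
  show "\<langle>s u, s v\<rangle> = \<langle>u, v\<rangle>" if "u \<in> V" "v \<in> V" for u v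
    using that by (simp add: x refl_map_isometry \<alpha>)
  have "s v = refl_map (simple_root x) v" if "v \<in> root_lattice" for v
    using that by (simp add: x root_lattice_def)
  then show "s ` root_lattice \<subseteq> root_lattice"
    using refl_map_root_lattice[OF \<alpha>(1)] by auto
qed

text \<open>Simple reflections are involutions, so inverses of generators are again generators and
  only composition remains. Isometry and integrality together keep the images of simple roots inside
  \<open>lattice_roots\<close>.\<close>

lemma extended_weyl_group_action:
  assumes "w \<in> extended_weyl_group r p"
  shows "w \<in> carrier G \<and> (\<forall>u\<in>V. \<forall>v\<in>V. \<langle>w u, w v\<rangle> = \<langle>u, v\<rangle>) \<and> w ` root_lattice \<subseteq> root_lattice"
  using assms unfolding extended_weyl_group_def
proof (induction rule: generate.induct)
  case one
  have "\<one>\<^bsub>G\<^esub> \<in> carrier G"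
    using group.is_monoid[OF group_GL] by (rule monoid.one_closed)
  moreover have "\<one>\<^bsub>G\<^esub> v = v" if "v \<in> V" for v
    using that by (simp add: GL_one)
  ultimately show ?case
    by (auto simp: root_lattice_def)
next
  case (incl s)
  then show ?case by (rule simple_reflection_action)
next
  case (inv s)
  then show ?case by (simp add: inv_simple_reflection simple_reflection_action)
next
  case (eng f g)
  then have fg: "f \<otimes>\<^bsub>G\<^esub> g \<in> carrier G" "\<And>v. v \<in> V \<Longrightarrow> (f \<otimes>\<^bsub>G\<^esub> g) v = f (g v)"
    using group.is_monoid[OF group_GL, THEN monoid.m_closed, of f g]
    by (auto simp: GL_mult compose_eq)
  moreover have "(f \<otimes>\<^bsub>G\<^esub> g) v = f (g v)" if "v \<in> root_lattice" for v
    using that fg by (simp add: root_lattice_def)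
  then have "(f \<otimes>\<^bsub>G\<^esub> g) ` root_lattice \<subseteq> root_lattice"
    using eng by (auto simp: image_subset_iff)
  ultimately show ?case
    using eng carrier_GL_closed by simp
qed

text \<open>Conjugating a reflection by an isometry \<open>w\<close> gives the reflection in the
  image of its root, so \<beta> is \<open>w\<close> applied to a simple root.\<close>

lemma reflections_lattice_root:
  assumes "t \<in> reflections r p"
  obtains \<beta> where "\<beta> \<in> lattice_roots" "t = restrict (refl_map \<beta>) V"
proof -
  interpret group G by (rule group_GL)
  obtain w s where t: "t = w \<otimes>\<^bsub>G\<^esub> s \<otimes>\<^bsub>G\<^esub> inv\<^bsub>G\<^esub> w"
    and w: "w \<in> extended_weyl_group r p" and s: "s \<in> simple_reflections r p"
    using assms by (auto simp: reflections_def)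
  obtain x where x: "x \<in> X" and s_eq: "s = restrict (refl_map (simple_root x)) V"
    using s by (rule simple_reflection_cases)
  let ?\<alpha> = "simple_root x"
  have \<alpha>: "?\<alpha> \<in> V" "?\<alpha> \<in> lattice_roots" using x by (auto simp: simple_root_lattice_root)
  note wW = extended_weyl_group_action[OF w]
  then have wG: "w \<in> carrier G" by simp
  have sG: "s \<in> carrier G" using s simple_reflections_subset by auto
  have "w ?\<alpha> \<in> lattice_roots"
    using wW \<alpha> by (auto simp: lattice_roots_def)
  moreover have "t v = refl_map (w ?\<alpha>) v" if v: "v \<in> V" for v
  proof -
    define u where "u = (inv\<^bsub>G\<^esub> w) v"
    have u: "u \<in> V" using v wG by (simp add: u_def carrier_GL_closed)
    have "(w \<otimes>\<^bsub>G\<^esub> inv\<^bsub>G\<^esub> w) v = v" using wG v by (simp add: GL_one)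
    then have wu: "w u = v" using wG v by (simp add: u_def GL_mult compose_eq)
    have su: "refl_map ?\<alpha> u \<in> V" using u \<alpha> by (simp add: refl_map_in_root_space)
    have "t v = w (refl_map ?\<alpha> u)"
      using wG sG v u by (simp add: t GL_mult[of _ "inv\<^bsub>G\<^esub> w"] compose_eq flip: u_def)
        (simp add: GL_mult compose_eq s_eq)
    also have "\<dots> = w (u + (- \<langle>?\<alpha>, u\<rangle>) *\<^sub>R ?\<alpha>)" by (simp add: refl_map_def)
    also have "\<dots> = w u + (- \<langle>?\<alpha>, u\<rangle>) *\<^sub>R w ?\<alpha>"
      using wG u \<alpha>(1) subspace_scale[OF subspace_root_space \<alpha>(1)]
      unfolding carrier_GL by (metis (no_types, lifting))
    also have "\<langle>?\<alpha>, u\<rangle> = \<langle>w ?\<alpha>, v\<rangle>" using wW u \<alpha>(1) wu by metis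
    finally show ?thesis by (simp add: refl_map_def wu)
  qed
  \<comment> \<open>Both maps are \<open>undefined\<close> outside \<open>V\<close>, so agreement on
    \<open>V\<close> makes them equal as functions.\<close>
  moreover have "t \<in> extensional V"
    using wG sG unfolding t by (simp add: GL_mult[of "w \<otimes>\<^bsub>G\<^esub> s"])
  ultimately show ?thesis
    by (intro that[of "w ?\<alpha>"]) (auto simp: extensional_def)
qed

section \<open>Products of reflections as maps on the ambient space\<close>

definition refl_prod :: "vec list \<Rightarrow> vec \<Rightarrow> vec" where
  "refl_prod \<beta>s = foldr refl_map \<beta>s"

lemma refl_prod_simps [simp]:
  "refl_prod [] v = v" "refl_prod (\<beta> # \<beta>s) v = refl_map \<beta> (refl_prod \<beta>s v)"
  "refl_prod (\<beta>s @ \<gamma>s) v = refl_prod \<beta>s (refl_prod \<gamma>s v)"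
  by (simp_all add: refl_prod_def)

lemma linear_refl_prod: "linear (refl_prod \<beta>s)"
proof (induction \<beta>s)
  case Nil
  show ?case by (rule linearI) simp_all
next
  case (Cons \<beta> \<beta>s)
  then show ?case
    by (intro linearI)
      (simp_all add: linear_add[OF Cons] linear_scale[OF Cons] linear_add[OF linear_refl_map]
        linear_scale[OF linear_refl_map])
qed

lemma refl_prod_in_root_space: "set \<beta>s \<subseteq> V \<Longrightarrow> v \<in> V \<Longrightarrow> refl_prod \<beta>s v \<in> V"
  by (induction \<beta>s) (auto simp: refl_map_in_root_space)

text \<open>Each factor moves a vector only along its own root.\<close>

lemma refl_prod_displacement: "refl_prod \<beta>s v - v \<in> span (set \<beta>s)"
proof (induction \<beta>s)
  case Nil
  show ?case by (simp add: span_zero)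
next
  case (Cons \<beta> \<beta>s)
  let ?w = "refl_prod \<beta>s v"
  have "?w - v \<in> span (set (\<beta> # \<beta>s))"
    using Cons span_mono[of "set \<beta>s" "set (\<beta> # \<beta>s)"] by auto
  moreover have "\<langle>\<beta>, ?w\<rangle> *\<^sub>R \<beta> \<in> span (set (\<beta> # \<beta>s))"
    by (intro span_scale span_base) simp
  ultimately have "(?w - v) - \<langle>\<beta>, ?w\<rangle> *\<^sub>R \<beta> \<in> span (set (\<beta> # \<beta>s))"
    by (rule span_diff)
  then show ?case by (simp add: refl_map_def algebra_simps)
qed

lemma list_product_closed:
  assumes "set fs \<subseteq> carrier G"
  shows "list_product G fs \<in> carrier G"
proof -
  interpret group G by (rule group_GL)
  show ?thesis using assms by (induction fs) (auto simp: list_product_def)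
qed

text \<open>The bridge from the group, whose products are compositions cut down to \<open>V\<close>,
  to plain compositions of linear maps, on which the later arguments operate.\<close>

lemma list_product_refl_maps:
  assumes "set \<beta>s \<subseteq> lattice_roots" "v \<in> V"
  shows "list_product G (map (reflection r p) \<beta>s) v = refl_prod \<beta>s v"
  using assms
proof (induction \<beta>s)
  case Nil
  then show ?case by (simp add: list_product_def GL_one)
next
  case (Cons \<beta> \<beta>s)
  have *: "reflection r p \<beta>' = restrict (refl_map \<beta>') V" "restrict (refl_map \<beta>') V \<in> carrier G"
    if "\<beta>' \<in> lattice_roots" for \<beta>'
    using that lattice_roots_subset
    by (auto simp: lattice_roots_def intro!: reflection_eq refl_map_in_GL)
  have "list_product G (map (reflection r p) \<beta>s) \<in> carrier G"
    using * Cons.prems by (intro list_product_closed) auto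
  then have "list_product G (map (reflection r p) (\<beta> # \<beta>s)) v
      = compose V (reflection r p \<beta>) (list_product G (map (reflection r p) \<beta>s)) v"
    using * Cons.prems by (simp add: list_product_def GL_mult)
  also have "\<dots> = refl_map \<beta> (refl_prod \<beta>s v)"
    using Cons * lattice_roots_subset refl_prod_in_root_space[of \<beta>s v]
    by (auto simp: compose_eq)
  finally show ?case by simp
qed

section \<open>Determinants and the parity of factorisations\<close>

definition vertex_list :: "vertex list" where
  "vertex_list = (SOME xs. distinct xs \<and> set xs = X)"

lemma vertex_list: "distinct vertex_list" "set vertex_list = X"
  using someI_ex[OF finite_distinct_list[OF finite_vertices]]
  by (auto simp: vertex_list_def conj_commute)

lemma length_vertex_list: "length vertex_list = card X"
  using vertex_list distinct_card by metis

lemma bij_vertex_list: "bij_betw (nth vertex_list) {0..<card X} X"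
  by (rule bij_betw_nth[OF vertex_list(1)])
    (simp_all add: atLeast0LessThan vertex_list(2) length_vertex_list)

lemma nth_vertex_list: "i < card X \<Longrightarrow> vertex_list ! i \<in> X"
  using vertex_list length_vertex_list nth_mem by metis

lemma nth_vertex_list_inject:
  "i < card X \<Longrightarrow> j < card X \<Longrightarrow> vertex_list ! i = vertex_list ! j \<longleftrightarrow> i = j"
  using vertex_list length_vertex_list nth_eq_iff_index_eq by metis

text \<open>The basis order comes from an arbitrary enumeration; only determinants are read off in
  the end, and they do not depend on it.\<close>

definition matrix_of :: "(vec \<Rightarrow> vec) \<Rightarrow> real mat" where
  "matrix_of f = mat (card X) (card X)
     (\<lambda>(i, j). Poly_Mapping.lookup (f (simple_root (vertex_list ! j))) (vertex_list ! i))"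

lemma matrix_of_carrier [simp]: "matrix_of f \<in> carrier_mat (card X) (card X)"
  by (simp add: matrix_of_def)

text \<open>Group elements are additive and homogeneous on \<open>V\<close> only, so compatibility
  with sums is obtained by an induction that stays inside \<open>V\<close>.\<close>

lemma GL_linear_combination:
  assumes f: "f \<in> carrier G" and v: "\<And>i. i \<in> I \<Longrightarrow> v i \<in> V"
  shows "f (\<Sum>i\<in>I. a i *\<^sub>R v i) = (\<Sum>i\<in>I. a i *\<^sub>R f (v i))"
proof -
  have "0 \<in> V" by (rule subspace_0[OF subspace_root_space])
  with f have "f (0 *\<^sub>R 0) = 0 *\<^sub>R f 0" unfolding carrier_GL by blast
  then have f0: "f 0 = 0" by simp
  show ?thesis
    using v
  proof (induction I rule: infinite_finite_induct)
    case (insert i I)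
    have "a i *\<^sub>R v i \<in> V" "(\<Sum>i\<in>I. a i *\<^sub>R v i) \<in> V"
      using insert.prems by (auto intro!: subspace_sum subspace_scale subspace_root_space)
    then have "f (a i *\<^sub>R v i + (\<Sum>i\<in>I. a i *\<^sub>R v i)) = f (a i *\<^sub>R v i) + f (\<Sum>i\<in>I. a i *\<^sub>R v i)"
      using f unfolding carrier_GL by blast
    also have "f (a i *\<^sub>R v i) = a i *\<^sub>R f (v i)"
      using f insert.prems unfolding carrier_GL by blast
    finally show ?case using insert by simp
  qed (simp_all add: f0)
qed

lemma matrix_of_mult:
  assumes f: "f \<in> carrier G" and g: "g \<in> carrier G"
  shows "matrix_of (f \<otimes>\<^bsub>G\<^esub> g) = matrix_of f * matrix_of g"
proof (rule eq_matI)
  fix i j assume "i < dim_row (matrix_of f * matrix_of g)" "j < dim_col (matrix_of f * matrix_of g)"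
  then have ij: "i < card X" "j < card X" by (simp_all add: matrix_of_def)
  let ?e = "\<lambda>k. simple_root (vertex_list ! k)" and ?v = "g (simple_root (vertex_list ! j))"
  have v: "?v \<in> V" using g ij by (simp add: carrier_GL_closed nth_vertex_list)
  then have "?v = (\<Sum>x\<in>X. Poly_Mapping.lookup ?v x *\<^sub>R simple_root x)"
    by (intro simple_root_expansion finite_vertices) (simp add: mem_root_space)
  then have "f ?v = f (\<Sum>x\<in>X. Poly_Mapping.lookup ?v x *\<^sub>R simple_root x)"
    by (rule arg_cong)
  also have "\<dots> = (\<Sum>x\<in>X. Poly_Mapping.lookup ?v x *\<^sub>R f (simple_root x))"
    by (rule GL_linear_combination[OF f]) simp
  also have "\<dots> = (\<Sum>k = 0..<card X. Poly_Mapping.lookup ?v (vertex_list ! k) *\<^sub>R f (?e k))"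
    by (rule sum.reindex_bij_betw[OF bij_vertex_list, symmetric])
  finally show "matrix_of (f \<otimes>\<^bsub>G\<^esub> g) $$ (i, j) = (matrix_of f * matrix_of g) $$ (i, j)"
    using ij f g nth_vertex_list[OF ij(2)]
    by (simp add: matrix_of_def GL_mult compose_eq scalar_prod_def lookup_sum mult.commute)
qed (simp_all add: matrix_of_def)

lemma matrix_of_one: "matrix_of \<one>\<^bsub>G\<^esub> = 1\<^sub>m (card X)"
  by (rule eq_matI)
    (auto simp: matrix_of_def GL_one nth_vertex_list lookup_simple_root nth_vertex_list_inject)

text \<open>A simple reflection changes only the coordinate of its own vertex, so its matrix differs
  from the identity in a single row \<open>k\<close>, and only the identity permutation survives in
  the Leibniz formula.\<close>

lemma det_simple_reflection:
  assumes "s \<in> simple_reflections r p"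
  shows "det (matrix_of s) = -1"
proof -
  obtain x where x: "x \<in> X" and s: "s = restrict (refl_map (simple_root x)) V"
    using assms by (rule simple_reflection_cases)
  obtain k where k: "k < card X" "vertex_list ! k = x"
    using x vertex_list length_vertex_list by (metis in_set_conv_nth)
  let ?A = "matrix_of s" and ?n = "card X"
  have entry: "?A $$ (i, j) = (if i = j then 1 else 0) - (if i = k then gram r p x (vertex_list ! j) else 0)"
    if "i < ?n" "j < ?n" for i j
    using that k x nth_vertex_list[OF that(2)]
    by (auto simp: matrix_of_def s refl_map_def lookup_minus lookup_simple_root
        nth_vertex_list_inject form_simple_roots)
  have vanish: "(\<Prod>i = 0..<?n. ?A $$ (i, q i)) = 0" if q: "q permutes {0..<?n}" "q \<noteq> id" for q
  proof -
    \<comment> \<open>A permutation fixing every index other than \<open>k\<close> also fixes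
      \<open>k\<close>; a nontrivial one therefore meets an off-diagonal entry outside row
      \<open>k\<close>, which is 0.\<close>
    have "\<exists>i. i \<noteq> k \<and> q i \<noteq> i"
    proof (rule ccontr)
      assume "\<not> ?thesis"
      then have fix_others: "q i = i" if "i \<noteq> k" for i using that by blast
      then have "q k = k" using permutes_inj[OF q(1)] by (metis injD)
      with fix_others have "q = id" by (metis eq_id_iff)
      with q show False by simp
    qed
    then obtain i where i: "i \<noteq> k" "q i \<noteq> i" by blast
    then have "i < ?n" using q(1) by (metis atLeastLessThan_iff permutes_not_in zero_le)
    moreover from this have "q i < ?n" using permutes_in_image[OF q(1), of i] by simp
    ultimately have "?A $$ (i, q i) = 0" using i by (simp add: entry)
    then show ?thesis using \<open>i < ?n\<close> by (intro prod_zero) auto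
  qed
  have "det ?A = (\<Sum>q \<in> {q. q permutes {0..<?n}}. signof q * (\<Prod>i = 0..<?n. ?A $$ (i, q i)))"
    by (rule det_def') simp
  also have "\<dots> = (\<Sum>q \<in> {id}. signof q * (\<Prod>i = 0..<?n. ?A $$ (i, q i)))"
    by (rule sum.mono_neutral_right) (auto simp: finite_permutations permutes_id vanish)
  also have "\<dots> = (\<Prod>i = 0..<?n. ?A $$ (i, i))"
    by (simp add: sign_id)
  \<comment> \<open>The diagonal entry in row \<open>k\<close> is 1 minus the norm 2 of the
    root.\<close>
  also have "\<dots> = (\<Prod>i = 0..<?n. if i = k then -1 else 1)"
    by (rule prod.cong) (use k in \<open>auto simp: entry\<close>)
  also have "\<dots> = -1" using k by simp
  finally show ?thesis .
qed

text \<open>Conjugation leaves the determinant unchanged, because the determinants of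
  \<open>w\<close> and of its inverse multiply to 1.\<close>

lemma det_reflection:
  assumes "t \<in> reflections r p"
  shows "t \<in> carrier G" "det (matrix_of t) = -1"
proof -
  interpret group G by (rule group_GL)
  obtain w s where t: "t = w \<otimes>\<^bsub>G\<^esub> s \<otimes>\<^bsub>G\<^esub> inv\<^bsub>G\<^esub> w"
    and w: "w \<in> extended_weyl_group r p" and s: "s \<in> simple_reflections r p"
    using assms by (auto simp: reflections_def)
  have wG: "w \<in> carrier G" and sG: "s \<in> carrier G"
    using extended_weyl_group_action[OF w] s simple_reflections_subset by auto
  then show "t \<in> carrier G" by (simp add: t)
  have "det (matrix_of w) * det (matrix_of (inv\<^bsub>G\<^esub> w)) = det (matrix_of (w \<otimes>\<^bsub>G\<^esub> inv\<^bsub>G\<^esub> w))"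
    using wG by (subst matrix_of_mult) (simp_all add: det_mult[of _ "card X"])
  also have "\<dots> = 1" using wG by (simp add: matrix_of_one)
  finally have "det (matrix_of w) * det (matrix_of (inv\<^bsub>G\<^esub> w)) = 1" .
  moreover have "det (matrix_of t)
      = det (matrix_of w) * det (matrix_of s) * det (matrix_of (inv\<^bsub>G\<^esub> w))"
    using wG sG by (simp add: t matrix_of_mult det_mult[of _ "card X"] mult_carrier_mat[of _ "card X" "card X"])
  ultimately show "det (matrix_of t) = -1"
    using det_simple_reflection[OF s] by simp
qed

lemma det_list_product:
  assumes "set ts \<subseteq> reflections r p"
  shows "det (matrix_of (list_product G ts)) = (-1) ^ length ts"
  using assms
proof (induction ts)
  case Nil
  then show ?case by (simp add: list_product_def matrix_of_one)
next
  case (Cons t ts)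
  have "list_product G ts \<in> carrier G"
    using Cons.prems det_reflection by (intro list_product_closed) auto
  then have "matrix_of (list_product G (t # ts)) = matrix_of t * matrix_of (list_product G ts)"
    using Cons.prems det_reflection by (simp add: list_product_def matrix_of_mult)
  then show ?case
    using Cons det_reflection by (simp add: det_mult[of _ "card X"])
qed

section \<open>The radical vector, translation parts and the lower bound\<close>

abbreviation "\<alpha>\<^sub>1 \<equiv> simple_root One"
abbreviation "\<alpha>\<^sub>1' \<equiv> simple_root OneStar"

definition radical_root :: vec where
  "radical_root = \<alpha>\<^sub>1' - \<alpha>\<^sub>1"

text \<open>The projection along \<open>radical_root\<close> onto the vectors without
  \<open>OneStar\<close> coordinate: it replaces the quotient by the line of
  \<open>radical_root\<close> with a concrete complement.\<close>

definition proj :: "vec \<Rightarrow> vec" where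
  "proj v = v - Poly_Mapping.lookup v OneStar *\<^sub>R radical_root"

lemma form_radical_root [simp]: "\<langle>radical_root, v\<rangle> = 0" "\<langle>v, radical_root\<rangle> = 0"
  by (simp_all add: radical_root_def form_OneStar form_sym[of v])

lemma linear_proj: "linear proj"
  by (rule linearI) (auto simp: proj_def lookup_add algebra_simps)

lemma form_proj: "\<langle>proj u, v\<rangle> = \<langle>u, v\<rangle>"
  by (simp add: proj_def)

lemma proj_radical_root: "proj radical_root = 0"
  by (simp add: proj_def radical_root_def lookup_minus lookup_simple_root)

lemma proj_arm_space: "v \<in> arm_space \<Longrightarrow> proj v = v"
  by (simp add: proj_def mem_arm_space)

lemma radical_root_in_root_lattice: "radical_root \<in> root_lattice"
  unfolding radical_root_def
  by (rule root_lattice_diff) (use simple_root_lattice_root in \<open>auto simp: lattice_roots_def\<close>)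

lemma proj_root_lattice: "v \<in> root_lattice \<Longrightarrow> proj v \<in> root_lattice"
  unfolding proj_def
  by (intro root_lattice_diff root_lattice_scale radical_root_in_root_lattice)
    (auto simp: root_lattice_def)

lemma refl_prod_radical_root: "refl_prod \<beta>s radical_root = radical_root"
  by (induction \<beta>s) (simp_all add: refl_map_def)

text \<open>The last two factors compose to a transvection along \<open>radical_root\<close>,
  because the two simple roots pair equally with every vector and have pairing 2 with each other.
  The other reflections fix \<open>radical_root\<close>, so its term passes through them
  unchanged.\<close>

lemma coxeter_product:
  "refl_prod (\<alpha>s @ [\<alpha>\<^sub>1, \<alpha>\<^sub>1']) v = refl_prod \<alpha>s v - \<langle>\<alpha>\<^sub>1, v\<rangle> *\<^sub>R radical_root"
proof -
  have "refl_map \<alpha>\<^sub>1 (refl_map \<alpha>\<^sub>1' v) = v - \<langle>\<alpha>\<^sub>1, v\<rangle> *\<^sub>R radical_root"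
    by (simp add: refl_map_def form_OneStar form_simple_roots gram_One_OneStar radical_root_def
        algebra_simps flip: scaleR_add_left)
  then show ?thesis
    by (simp add: linear_diff[OF linear_refl_prod] linear_scale[OF linear_refl_prod]
        refl_prod_radical_root)
qed

text \<open>Independent root directions cannot cancel each other, so a product fixes a vector only
  if every factor does. For the arm product this yields an injective displacement map.\<close>

lemma refl_prod_fixed_orthogonal:
  assumes "independent (set \<beta>s)" "distinct \<beta>s" "refl_prod \<beta>s v = v" "\<beta> \<in> set \<beta>s"
  shows "\<langle>\<beta>, v\<rangle> = 0"
  using assms
proof (induction \<beta>s)
  case (Cons \<gamma> \<beta>s)
  let ?w = "refl_prod \<beta>s v"
  have indep: "independent (set \<beta>s)" "\<gamma> \<notin> span (set \<beta>s)"
    using Cons.prems by (auto simp: independent_insert)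
  \<comment> \<open>The outermost factor can undo the displacement of the remaining ones only along
    \<gamma>, while that displacement lies in the span of the remaining roots.\<close>
  have "\<langle>\<gamma>, ?w\<rangle> *\<^sub>R \<gamma> = ?w - v"
    using Cons.prems by (auto simp: refl_map_def algebra_simps)
  then have "\<langle>\<gamma>, ?w\<rangle> *\<^sub>R \<gamma> \<in> span (set \<beta>s)"
    using refl_prod_displacement by simp
  then have "\<langle>\<gamma>, ?w\<rangle> = 0"
    using indep(2) span_scale[of "\<langle>\<gamma>, ?w\<rangle> *\<^sub>R \<gamma>" "set \<beta>s" "1 / \<langle>\<gamma>, ?w\<rangle>"] by (cases "\<langle>\<gamma>, ?w\<rangle> = 0") auto
  moreover from this have "?w = v"
    using Cons.prems by (simp add: refl_map_def)
  ultimately show ?case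
    using Cons indep(1) by auto
qed simp

text \<open>The group is a semidirect product of the reflection group acting modulo the radical vector
  with a lattice of translations; this extracts the translation part of a product of reflections.\<close>

lemma refl_prod_translation:
  assumes "set \<beta>s \<subseteq> lattice_roots"
  obtains z where "z \<in> span (set \<beta>s)" "z \<in> root_lattice"
    "\<And>v. Poly_Mapping.lookup (refl_prod \<beta>s v - v) OneStar = - \<langle>z, v\<rangle>"
proof -
  have "\<exists>z. z \<in> span (set \<beta>s) \<and> z \<in> root_lattice \<and>
    (\<forall>v. Poly_Mapping.lookup (refl_prod \<beta>s v - v) OneStar = - \<langle>z, v\<rangle>)"
    using assms
  proof (induction \<beta>s rule: rev_induct)
    case Nil
    show ?case by (rule exI[of _ 0]) (auto simp: root_lattice_def mem_root_space span_zero)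
  next
    case (snoc \<beta> \<beta>s)
    then obtain z where z: "z \<in> span (set \<beta>s)" "z \<in> root_lattice"
      "\<And>v. Poly_Mapping.lookup (refl_prod \<beta>s v - v) OneStar = - \<langle>z, v\<rangle>"
      by auto
    have \<beta>: "\<beta> \<in> root_lattice" using snoc.prems by (auto simp: lattice_roots_def)
    let ?k = "Poly_Mapping.lookup \<beta> OneStar" and ?S = "set (\<beta>s @ [\<beta>])"
    \<comment> \<open>The displacement of \<open>v\<close> splits into that of
      \<open>refl_map \<beta> v\<close> under \<open>\<beta>s\<close> and a term along \<beta>.
      Self-adjointness moves the reflection onto \<open>z\<close>, which gives the first summand;
      the \<open>OneStar\<close> coordinate of the term along \<beta> gives the second.\<close>
    let ?z = "refl_map \<beta> z + ?k *\<^sub>R \<beta>"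
    have "z \<in> span ?S" "\<beta> \<in> span ?S"
      using z(1) span_mono[of "set \<beta>s" ?S] by (auto intro: span_base)
    then have "?z \<in> span ?S"
      unfolding refl_map_def by (intro span_add span_diff span_scale)
    moreover have "?z \<in> root_lattice"
      using \<beta> z(2) by (intro root_lattice_add root_lattice_scale refl_map_root_lattice)
        (auto simp: root_lattice_def)
    moreover have "Poly_Mapping.lookup (refl_prod (\<beta>s @ [\<beta>]) v - v) OneStar = - \<langle>?z, v\<rangle>" for v
      using z(3)[of "refl_map \<beta> v"]
      by (simp add: refl_map_self_adjoint lookup_minus) (simp add: refl_map_def lookup_minus algebra_simps)
    ultimately show ?case by blast
  qed
  then show thesis using that by blast
qed

text \<open>The bound \<open>card arms\<close>, the rank minus 2, is exactly the dimension filled by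
  the displacements of the arm product; with one root more, a projected root could leave
  \<open>arm_space\<close>.\<close>

lemma coxeter_product_lower_bound:
  assumes \<alpha>s: "distinct \<alpha>s" "set \<alpha>s = simple_root ` arms"
    and \<beta>s: "set \<beta>s \<subseteq> lattice_roots" "length \<beta>s \<le> card arms"
    and eq: "\<And>v. v \<in> V \<Longrightarrow> refl_prod \<beta>s v = refl_prod (\<alpha>s @ [\<alpha>\<^sub>1, \<alpha>\<^sub>1']) v"
  shows False
proof -
  define g where "g v = refl_prod \<alpha>s v - v" for v
  have lin_g: "linear g"
    by (rule linearI)
      (simp_all add: g_def linear_add[OF linear_refl_prod] linear_scale[OF linear_refl_prod] algebra_simps)
  have gA: "g v \<in> arm_space" for v
    using refl_prod_displacement[of \<alpha>s v] by (simp add: g_def \<alpha>s)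
  have displacement: "refl_prod \<beta>s v - v = g v - \<langle>\<alpha>\<^sub>1, v\<rangle> *\<^sub>R radical_root" if "v \<in> V" for v
    using eq[OF that] unfolding coxeter_product by (simp add: g_def)
  have indep: "independent (set \<alpha>s)"
    unfolding \<alpha>s by (rule independent_simple_roots) (simp add: finite_vertices)
  \<comment> \<open>A vector fixed by the arm product is orthogonal to all arm roots, and the form
    is nondegenerate on \<open>arm_space\<close>.\<close>
  have inj: "inj_on g arm_space"
  proof (rule inj_onI)
    fix u v assume uv: "u \<in> arm_space" "v \<in> arm_space" "g u = g v"
    then have "g (u - v) = 0" by (simp add: linear_diff[OF lin_g])
    then have "refl_prod \<alpha>s (u - v) = u - v" by (simp add: g_def)
    then have "\<langle>simple_root x, u - v\<rangle> = 0" if "x \<in> arms" for x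
      using refl_prod_fixed_orthogonal[OF indep \<alpha>s(1)] \<alpha>s(2) that by blast
    then have "u - v = 0"
      using uv by (intro form_nondegenerate_on_arm_space span_diff)
    then show "u = v" by simp
  qed
  have indep_g: "independent (g ` set \<alpha>s)"
    using linear_independent_injective_image[OF lin_g indep] inj by (simp add: \<alpha>s)
  have "set \<alpha>s \<subseteq> arm_space" unfolding \<alpha>s by (rule span_superset)
  then have card_g: "card (g ` set \<alpha>s) = card arms"
    using inj inj_on_subset by (metis \<alpha>s(2) card_image inj_simple_root)
  \<comment> \<open>\<open>proj\<close> removes the radical term of the displacement and leaves its
    arm part unchanged, so the projected roots must span all values of \<open>g\<close>.\<close>
  have g_span: "g v \<in> span (proj ` set \<beta>s)" if "v \<in> V" for v
  proof -
    have "proj (refl_prod \<beta>s v - v) \<in> proj ` span (set \<beta>s)"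
      by (intro imageI refl_prod_displacement)
    then show ?thesis
      unfolding displacement[OF that] linear_span_image[OF linear_proj]
      by (simp add: linear_diff[OF linear_proj] linear_scale[OF linear_proj]
          proj_radical_root proj_arm_space gA)
  qed
  \<comment> \<open>Otherwise \<open>card arms + 1\<close> independent vectors would lie in the span
    of at most \<open>card arms\<close> projected roots.\<close>
  have proj_in_A: "proj \<beta> \<in> arm_space" if \<beta>: "\<beta> \<in> set \<beta>s" for \<beta>
  proof (rule ccontr)
    assume notin: "proj \<beta> \<notin> arm_space"
    have "span (g ` set \<alpha>s) \<subseteq> arm_space"
      by (rule span_minimal) (use gA in auto)
    then have new: "proj \<beta> \<notin> span (g ` set \<alpha>s)" using notin by blast
    have "insert (proj \<beta>) (g ` set \<alpha>s) \<subseteq> span (proj ` set \<beta>s)"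
      using \<beta> g_span \<open>set \<alpha>s \<subseteq> arm_space\<close> arm_space_subset by (auto intro: span_base)
    then have "card (insert (proj \<beta>) (g ` set \<alpha>s)) \<le> card (proj ` set \<beta>s)"
      using independent_span_bound independent_insertI[OF new indep_g] by blast
    moreover have "card (insert (proj \<beta>) (g ` set \<alpha>s)) = card arms + 1"
      using new span_base[of "proj \<beta>" "g ` set \<alpha>s"] card_g by (subst card_insert_disjoint) auto
    moreover have "card (proj ` set \<beta>s) \<le> length \<beta>s"
      using card_image_le[of "set \<beta>s" proj] card_length[of \<beta>s] by simp
    ultimately show False using \<beta>s(2) by simp
  qed
  obtain z where z: "z \<in> span (set \<beta>s)" "z \<in> root_lattice"
    "\<And>v. Poly_Mapping.lookup (refl_prod \<beta>s v - v) OneStar = - \<langle>z, v\<rangle>"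
    using refl_prod_translation[OF \<beta>s(1)] by blast
  \<comment> \<open>This changes \<open>z\<close> by an integral multiple of
    \<open>radical_root\<close>: pairings and integrality survive, and the result lies in
    \<open>arm_space\<close>.\<close>
  define x where "x = proj z"
  have "x \<in> span (proj ` set \<beta>s)"
    using z(1) by (simp add: x_def linear_span_image[OF linear_proj])
  moreover have "span (proj ` set \<beta>s) \<subseteq> arm_space"
    by (rule span_minimal) (use proj_in_A in auto)
  ultimately have xA: "x \<in> arm_space" by blast
  have x_int: "x \<in> root_lattice"
    using z(2) by (simp add: x_def proj_root_lattice)
  \<comment> \<open>The two products are compared in the \<open>OneStar\<close> coordinate, where
    \<open>g v\<close> contributes 0 and \<open>radical_root\<close> has coordinate 1.\<close>
  have x_form: "\<langle>v, x\<rangle> = \<langle>\<alpha>\<^sub>1, v\<rangle>" if "v \<in> V" for v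
  proof -
    have "Poly_Mapping.lookup (g v) OneStar = 0" using gA by (simp add: mem_arm_space)
    then have "\<langle>z, v\<rangle> = \<langle>\<alpha>\<^sub>1, v\<rangle>"
      using z(3)[of v] displacement[OF that]
      by (simp add: lookup_minus radical_root_def lookup_simple_root)
    then show ?thesis by (simp add: x_def form_sym[of v] form_proj)
  qed
  show False
  proof (cases "\<exists>i. Arm i 1 \<in> X")
    case True
    then obtain i where i: "Arm i 1 \<in> X" by blast
    then have p: "p i > 1" by (simp add: Arm_in_vertices)
    have pairing: "\<langle>simple_root (Arm i j), x\<rangle> = (if j = 1 then -1 else 0)" if "1 \<le> j" "j < p i" for j
    proof -
      have "Arm i j \<in> X" using that i by (simp add: Arm_in_vertices)
      then show ?thesis by (simp add: x_form form_simple_roots gram_One_Arm)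
    qed
    \<comment> \<open>The affine formula is evaluated at position 1, with pairing -1 at the first
      vertex and 0 further out.\<close>
    have "real (p i) * Poly_Mapping.lookup x (Arm i 1) = - real (p i - 1)"
      using arm_discrete_harmonic[OF xA i, of 1] pairing p by simp
    moreover obtain k where "Poly_Mapping.lookup x (Arm i 1) = of_int k"
      using x_int by (auto simp: root_lattice_def elim: Ints_cases)
    ultimately have "real_of_int (int (p i) * k) = real_of_int (- int (p i - 1))" by simp
    then have "int (p i) * k = - int (p i - 1)" by linarith
    then have "int (p i) dvd int (p i - 1)" by (metis dvd_minus_iff dvd_triv_left)
    then have "p i dvd p i - 1" by simp
    \<comment> \<open>As \<open>p i > 1\<close>, the number \<open>p i - 1\<close> is positive and
      smaller than \<open>p i\<close>, hence not a multiple of it.\<close>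
    then show False using p by (auto dest: dvd_imp_le)
  next
    case False
    \<comment> \<open>Without arm vertices \<open>arm_space\<close> is zero, so \<open>x\<close>
      vanishes, although its pairing with \<open>\<alpha>\<^sub>1\<close> would have to be the norm
      2.\<close>
    have "arms = {}"
    proof (rule ccontr)
      assume "arms \<noteq> {}"
      then obtain y where y: "y \<in> arms" by blast
      then obtain i j where "y = Arm i j" by (cases y) auto
      with y have "Arm i 1 \<in> X" by (auto simp: Arm_in_vertices)
      with False show False by blast
    qed
    with xA have "x = 0" by (simp only: image_empty span_empty singleton_iff)
    then show False using x_form[of \<alpha>\<^sub>1] by (simp add: form_simple_roots)
  qed
qed

section \<open>The rank and the reflection length\<close>

lemma card_simple_reflections: "card (simple_reflections r p) = card X"
proof -
  have "inj_on (reflection r p) (simple_roots r p)"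
  proof (rule inj_onI)
    fix u v assume "u \<in> simple_roots r p" "v \<in> simple_roots r p" and eq: "reflection r p u = reflection r p v"
    then obtain x y where x: "x \<in> X" "u = simple_root x" and y: "y \<in> X" "v = simple_root y"
      by (auto simp: simple_roots_def)
    have uu: "\<langle>u, u\<rangle> = 2" "\<langle>v, v\<rangle> = 2" "u \<in> V" using x y by (auto simp: form_simple_roots)
    \<comment> \<open>A reflection negates its root, so twice \<open>u\<close> is a multiple of
      \<open>v\<close>. Coordinates then separate the roots, even those of \<open>One\<close> and
      \<open>OneStar\<close>, which the form cannot tell apart.\<close>
    have "refl_map u u = refl_map v u"
      using fun_cong[OF eq, of u] uu by (simp add: reflection_eq)
    then have "2 *\<^sub>R u = \<langle>v, u\<rangle> *\<^sub>R v"
      using uu by (simp add: refl_map_def)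
    then have "Poly_Mapping.lookup (2 *\<^sub>R u) x = Poly_Mapping.lookup (\<langle>v, u\<rangle> *\<^sub>R v) x" by simp
    then show "u = v" using x y by (auto simp: lookup_simple_root split: if_splits)
  qed
  then show ?thesis
    by (simp add: simple_reflections_def card_image simple_roots_def inj_simple_root)
qed

lemma simple_reflections_are_reflections: "simple_reflections r p \<subseteq> reflections r p"
proof
  fix s assume s: "s \<in> simple_reflections r p"
  interpret group G by (rule group_GL)
  have "s = \<one>\<^bsub>G\<^esub> \<otimes>\<^bsub>G\<^esub> s \<otimes>\<^bsub>G\<^esub> inv\<^bsub>G\<^esub> \<one>\<^bsub>G\<^esub>"
    using s simple_reflections_subset by auto
  moreover have "\<one>\<^bsub>G\<^esub> \<in> extended_weyl_group r p"
    unfolding extended_weyl_group_def by (rule generate.one)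
  ultimately show "s \<in> reflections r p"
    using s unfolding reflections_def by blast
qed

theorem reflection_length_coxeter:
  assumes "coxeter_transformation r p c"
  shows "reflection_length r p c = card (simple_reflections r p)"
proof -
  obtain \<alpha>s where \<alpha>s: "distinct \<alpha>s" "set \<alpha>s = simple_roots r p - {\<alpha>\<^sub>1, \<alpha>\<^sub>1'}"
    and c: "c = list_product G (map (reflection r p) (\<alpha>s @ [\<alpha>\<^sub>1, \<alpha>\<^sub>1']))"
    using assms by (auto simp: coxeter_transformation_def)
  have set_\<alpha>s: "set \<alpha>s = simple_root ` arms"
    unfolding \<alpha>s(2) simple_roots_def by auto
  have card_X: "card X = card arms + 2"
    using card_Diff_subset[of "{One, OneStar}" X] card_mono[of X "{One, OneStar}"] finite_vertices
    by simp
  have length_\<alpha>s: "length \<alpha>s = card arms"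
    using distinct_card[OF \<alpha>s(1)] by (simp add: set_\<alpha>s card_image inj_simple_root)
  define \<gamma>s where "\<gamma>s = \<alpha>s @ [\<alpha>\<^sub>1, \<alpha>\<^sub>1']"
  have \<gamma>s: "set \<gamma>s \<subseteq> simple_root ` X" "length \<gamma>s = card X"
  proof -
    show "set \<gamma>s \<subseteq> simple_root ` X"
      unfolding \<gamma>s_def set_append set_\<alpha>s
      by (intro Un_least image_mono Diff_subset) simp
    show "length \<gamma>s = card X"
      unfolding \<gamma>s_def length_append length_\<alpha>s card_X by simp
  qed
  \<comment> \<open>The defining factors of \<open>c\<close> are themselves reflections and witness
    the upper bound.\<close>
  define ss where "ss = map (reflection r p) \<gamma>s"
  have ss: "length ss = card X" "set ss \<subseteq> reflections r p" "list_product G ss = c"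
  proof -
    show "length ss = card X" by (simp add: ss_def \<gamma>s)
    show "list_product G ss = c" by (simp add: ss_def c \<gamma>s_def)
    have "set ss \<subseteq> simple_reflections r p"
      using \<gamma>s(1) by (auto simp: ss_def simple_reflections_def simple_roots_def)
    then show "set ss \<subseteq> reflections r p"
      using simple_reflections_are_reflections by blast
  qed
  have \<gamma>s_roots: "set \<gamma>s \<subseteq> lattice_roots"
    using \<gamma>s(1) simple_root_lattice_root by blast
  have lower: "card X \<le> length ts" if ts: "set ts \<subseteq> reflections r p" "list_product G ts = c" for ts
  proof (rule ccontr)
    assume less: "\<not> card X \<le> length ts"
    \<comment> \<open>Comparing determinants excludes a deficit of one: a factorisation with fewer
      than \<open>card X\<close> factors has the same parity, hence at most \<open>card arms\<close>
      factors.\<close>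
    have "(-1 :: real) ^ length ts = (-1) ^ card X"
      using det_list_product[OF ts(1)] det_list_product[OF ss(2)] ts(2) ss by simp
    then have "even (length ts) = even (card X)"
      by (metis neg_one_even_power neg_one_odd_power one_neq_neg_one)
    moreover have "length ts < card X" using less by (rule linorder_not_le[THEN iffD1])
    moreover have "l \<le> b" if "even l = even a" "l < a" "a = b + 2" for a b l :: nat
      using that by presburger
    ultimately have short: "length ts \<le> card arms"
      using card_X by metis
    have "\<forall>t\<in>set ts. \<exists>\<beta>. \<beta> \<in> lattice_roots \<and> t = reflection r p \<beta>"
    proof
      fix t assume "t \<in> set ts"
      then obtain \<beta> where "\<beta> \<in> lattice_roots" "t = restrict (refl_map \<beta>) V"
        using ts(1) reflections_lattice_root by blast
      then show "\<exists>\<beta>. \<beta> \<in> lattice_roots \<and> t = reflection r p \<beta>"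
        by (auto simp: lattice_roots_def reflection_eq)
    qed
    then obtain b where b: "\<And>t. t \<in> set ts \<Longrightarrow> b t \<in> lattice_roots \<and> t = reflection r p (b t)"
      by metis
    define \<beta>s where "\<beta>s = map b ts"
    have \<beta>s: "set \<beta>s \<subseteq> lattice_roots" "map (reflection r p) \<beta>s = ts"
      using b by (auto simp: \<beta>s_def intro!: map_idI)
    have "refl_prod \<beta>s v = refl_prod (\<alpha>s @ [\<alpha>\<^sub>1, \<alpha>\<^sub>1']) v" if "v \<in> V" for v
      using list_product_refl_maps[OF \<beta>s(1) that] list_product_refl_maps[OF \<gamma>s_roots that]
      unfolding \<beta>s(2) ts(2) by (simp add: c \<gamma>s_def)
    then show False
      using coxeter_product_lower_bound[OF \<alpha>s(1) set_\<alpha>s \<beta>s(1)] short by (simp add: \<beta>s_def)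
  qed
  have "card X \<le> m"
    if "\<exists>ts. length ts = m \<and> set ts \<subseteq> reflections r p \<and> list_product G ts = c" for m
    using that lower by blast
  moreover have "\<exists>ts. length ts = card X \<and> set ts \<subseteq> reflections r p \<and> list_product G ts = c"
    by (intro exI[of _ ss] conjI ss)
  ultimately show ?thesis
    unfolding reflection_length_def card_simple_reflections by (intro Least_equality)
qed

end

theorem proposition1p1:
  fixes r :: nat and p :: "nat \<Rightarrow> nat" and c :: "vec \<Rightarrow> vec"
  assumes "\<And>i. i \<in> {1..r} \<Longrightarrow> p i \<ge> 1"
    and "coxeter_transformation r p c"
  shows "reflection_length r p c = card (simple_reflections r p)"
  using assms(2) by (rule extended_diagram.reflection_length_coxeter)

end
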